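(* For all integers $k,l\geq 0$ we have $$\int_0^{2\pi}\cos^{2k}(\theta)\sin^{2l}(\theta)\,d\theta=2\pi\,2^{-2(k+l)}\,\frac{\binom{k+l-1}{l}\binom{2(k+l)}{k+l}}{\binom{2(k+l)-1}{2l}}.$$
   Context: For integers $N$ and $M$, $\binom{N}{M}$ denotes the binomial coefficient, i.e. the coefficient of $z^M$ in the power series expansion of $(1+z)^N$ at $z=0$.
   Formalization: For k = 0 and l ≥ 1 the right-hand side is 0/0 (both binom(l-1,l) and binom(2l-1,2l) vanish); there the quotient of these two binomials is read as its limit as k, taken real, tends to 0, with the other factors kept at k = 0. All other k, l ≥ 0 are stated literally. *)

theory Defs
  imports "HOL-Analysis.Analysis" "HOL-Computational_Algebra.Formal_Power_Series"
begin

(* (1 + X) powi N is the expansion at 0 also for N < 0, since 1 + X is a unit.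
   A power series has no terms of negative degree, whence the value 0 for M < 0. *)
definition int_binomial :: "int \<Rightarrow> int \<Rightarrow> real" where
  "int_binomial N M =
     (if M < 0 then 0 else fps_nth ((1 + fps_X :: real fps) powi N) (nat M))"

lemma int_binomial_gchoose: "int_binomial N (int m) = of_int N gchoose m"
proof (cases "N \<ge> 0")
  case True
  then obtain n where "N = int n"
    using nonneg_int_cases by blast
  then show ?thesis
    by (simp add: int_binomial_def fps_binomial_of_nat [symmetric])
next
  case False
  then obtain n where N: "N = - int n"
    by (metis int_cases2 nle_le of_nat_0_le_iff)
  have "(1 + fps_X :: real fps) powi N = inverse ((1 + fps_X) ^ n)"
    by (cases n) (simp_all add: N power_int_def fps_inverse_power nat_add_distrib del: power_Suc)
  also have "\<dots> = fps_binomial (- of_nat n)"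
    by (simp add: fps_binomial_minus_of_nat)
  finally show ?thesis
    by (simp add: int_binomial_def N)
qed

(* For real x in place of the integer k, the quotient
     binom (x + l - 1, l) / binom (2 (x + l) - 1, 2 l)
   is a rational function of x.  For k = 0 < l both binomial coefficients vanish at x = k,
   which is a removable singularity; for all other k, l >= 0 the denominator is nonzero. *)
definition binomial_quotient :: "nat \<Rightarrow> real \<Rightarrow> real" where
  "binomial_quotient l x =
     ((x + real l - 1) gchoose l) / ((2 * (x + real l) - 1) gchoose (2 * l))"

lemma binomial_quotient_of_nat:
  "binomial_quotient l (real k) =
     int_binomial (int (k + l) - 1) (int l) / int_binomial (2 * int (k + l) - 1) (2 * int l)"
proof -
  have "int_binomial (2 * int (k + l) - 1) (2 * int l)
      = of_int (2 * int (k + l) - 1) gchoose (2 * l)"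
    using int_binomial_gchoose [of "2 * int (k + l) - 1" "2 * l"] by simp
  then show ?thesis
    by (simp add: binomial_quotient_def int_binomial_gchoose)
qed

end

theory Submission
  imports Defs
begin

text \<open>
  Both sides are compared with $2\pi\,(1/2)_k\,(1/2)_l / (k+l)!$, where $(a)_n$ is the rising
  factorial.  Let $I(k,l)$ be the integral.  Integrating the derivative of
  $\cos^{2k+1}\theta\,\sin^{2l+1}\theta$ over a full period and multiplying the integrand by
  $\cos^2\theta+\sin^2\theta$ give
  \[ (2l+1)\,I(k+1,l) = (2k+1)\,I(k,l+1), \qquad I(k,l) = I(k+1,l) + I(k,l+1), \]
  which determine $I$ from $I(0,0) = 2\pi$ (\<open>integral_cos_sin_even_powers\<close>).

  On the other side, the duplication formula for the rising factorial shows that, off the zeros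
  of $(x)_l$, the quotient of binomial coefficients at $x$ is $(1/2)_l / (x+1/2)_l$
  (\<open>binomial_quotient_eq\<close>).  The central binomial coefficient is
  $\binom{2n}{n} = 4^n (1/2)_n / n!$, and $(1/2)_{k+l} = (1/2)_k\,(k+1/2)_l$, so the factor
  $(k+1/2)_l$ cancels.  As $(x+1/2)_l$ is continuous and positive at $x = k$, the same
  computation yields the limit at the removable singularity.
\<close>

section \<open>The integral as a product of rising factorials\<close>

lemma has_integral_deriv_cos_sin_odd_powers:
  fixes k l :: nat
  shows "((\<lambda>\<theta>. (2 * real l + 1) * (cos \<theta> ^ (2 * Suc k) * sin \<theta> ^ (2 * l)) -
               (2 * real k + 1) * (cos \<theta> ^ (2 * k) * sin \<theta> ^ (2 * Suc l)))
          has_integral 0) {0..2 * pi}"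
proof -
  define F :: "real \<Rightarrow> real" where "F = (\<lambda>\<theta>. cos \<theta> ^ Suc (2 * k) * sin \<theta> ^ Suc (2 * l))"
  have "((\<lambda>\<theta>. (2 * real l + 1) * (cos \<theta> ^ (2 * Suc k) * sin \<theta> ^ (2 * l)) -
               (2 * real k + 1) * (cos \<theta> ^ (2 * k) * sin \<theta> ^ (2 * Suc l)))
          has_integral (F (2 * pi) - F 0)) {0..2 * pi}"
  proof (rule fundamental_theorem_of_calculus)
    fix x :: real
    have "(F has_real_derivative
            (2 * real l + 1) * (cos x ^ (2 * Suc k) * sin x ^ (2 * l)) -
            (2 * real k + 1) * (cos x ^ (2 * k) * sin x ^ (2 * Suc l))) (at x within {0..2 * pi})"
      unfolding F_def
      by (rule derivative_eq_intros refl | simp add: algebra_simps)+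
    then show "(F has_vector_derivative
            (2 * real l + 1) * (cos x ^ (2 * Suc k) * sin x ^ (2 * l)) -
            (2 * real k + 1) * (cos x ^ (2 * k) * sin x ^ (2 * Suc l))) (at x within {0..2 * pi})"
      by (simp only: has_real_derivative_iff_has_vector_derivative)
  qed simp
  then show ?thesis
    by (simp add: F_def)
qed

lemma integral_cos_sin_even_powers_recurrences:
  fixes k l :: nat
  defines "I \<equiv> \<lambda>k l. integral {0..2 * pi} (\<lambda>\<theta>. cos \<theta> ^ (2 * k) * sin \<theta> ^ (2 * l))"
  shows "I (Suc k) l = (2 * real k + 1) / (2 * (real k + real l + 1)) * I k l"
    and "I k (Suc l) = (2 * real l + 1) / (2 * (real k + real l + 1)) * I k l"
proof -
  have int: "((\<lambda>\<theta>. cos \<theta> ^ (2 * k) * sin \<theta> ^ (2 * l)) has_integral I k l) {0..2 * pi}" for k l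
    unfolding I_def
    by (intro integrable_integral integrable_continuous_interval continuous_intros)
  have "((\<lambda>\<theta>. (2 * real l + 1) * (cos \<theta> ^ (2 * Suc k) * sin \<theta> ^ (2 * l)) -
               (2 * real k + 1) * (cos \<theta> ^ (2 * k) * sin \<theta> ^ (2 * Suc l)))
          has_integral ((2 * real l + 1) * I (Suc k) l - (2 * real k + 1) * I k (Suc l))) {0..2 * pi}"
    by (intro has_integral_diff has_integral_mult_right int)
  then have parts: "(2 * real l + 1) * I (Suc k) l = (2 * real k + 1) * I k (Suc l)"
    using has_integral_unique [OF _ has_integral_deriv_cos_sin_odd_powers] by fastforce
  have "((\<lambda>\<theta>. cos \<theta> ^ (2 * Suc k) * sin \<theta> ^ (2 * l) + cos \<theta> ^ (2 * k) * sin \<theta> ^ (2 * Suc l))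
          has_integral (I (Suc k) l + I k (Suc l))) {0..2 * pi}"
    by (intro has_integral_add int)
  moreover have "cos \<theta> ^ (2 * Suc k) * sin \<theta> ^ (2 * l) + cos \<theta> ^ (2 * k) * sin \<theta> ^ (2 * Suc l) =
      cos \<theta> ^ (2 * k) * sin \<theta> ^ (2 * l)" for \<theta> :: real
  proof -
    have "cos \<theta> ^ (2 * Suc k) * sin \<theta> ^ (2 * l) + cos \<theta> ^ (2 * k) * sin \<theta> ^ (2 * Suc l) =
        cos \<theta> ^ (2 * k) * sin \<theta> ^ (2 * l) * ((cos \<theta>)\<^sup>2 + (sin \<theta>)\<^sup>2)"
      by (simp add: power2_eq_square distrib_left mult_ac del: sin_cos_squared_add sin_cos_squared_add2 sin_cos_squared_add3)
    then show ?thesis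
      by simp
  qed
  ultimately have pyth: "I (Suc k) l + I k (Suc l) = I k l"
    using has_integral_unique [OF _ int] by fastforce
  have pos: "2 * (real k + real l + 1) > 0"
    by simp
  have "2 * (real k + real l + 1) * I (Suc k) l = (2 * real k + 1) * I k l"
    using parts by (simp add: pyth [symmetric] algebra_simps)
  then show "I (Suc k) l = (2 * real k + 1) / (2 * (real k + real l + 1)) * I k l"
    using pos by (simp add: field_simps)
  have "2 * (real k + real l + 1) * I k (Suc l) = (2 * real l + 1) * I k l"
    using parts by (simp add: pyth [symmetric] algebra_simps)
  then show "I k (Suc l) = (2 * real l + 1) / (2 * (real k + real l + 1)) * I k l"
    using pos by (simp add: field_simps)
qed

lemma integral_cos_sin_even_powers:
  "integral {0..2 * pi} (\<lambda>\<theta>. cos \<theta> ^ (2 * k) * sin \<theta> ^ (2 * l)) =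
     2 * pi * pochhammer (1 / 2) k * pochhammer (1 / 2) l / fact (k + l)"
proof (induction l)
  case 0
  show ?case
  proof (induction k)
    case 0
    show ?case by simp
  next
    case (Suc k)
    show ?case
      unfolding integral_cos_sin_even_powers_recurrences(1) Suc.IH
      by (simp add: pochhammer_Suc field_simps)
  qed
next
  case (Suc l)
  show ?case
    unfolding integral_cos_sin_even_powers_recurrences(2) Suc.IH
    by (simp add: pochhammer_Suc field_simps)
qed

section \<open>The binomial side\<close>

text \<open>
  The factor $(x)_l$ of the numerator divides the denominator, which is a multiple of
  $(2x)_{2l} = 4^l (x)_l (x+1/2)_l$.
\<close>

lemma binomial_quotient_eq:
  assumes "pochhammer x l \<noteq> 0"
  shows "binomial_quotient l x = pochhammer (1 / 2) l / pochhammer (x + 1 / 2) l"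
proof -
  have num: "(x + real l - 1) gchoose l = pochhammer x l / fact l"
    by (simp add: gbinomial_pochhammer')
  have "(2 * (x + real l) - 1) gchoose (2 * l) = pochhammer (2 * x) (2 * l) / fact (2 * l)"
    by (simp add: gbinomial_pochhammer' algebra_simps)
  also have "\<dots> = pochhammer x l * pochhammer (x + 1 / 2) l / (pochhammer (1 / 2) l * fact l)"
    by (simp add: pochhammer_double fact_double)
  finally show ?thesis
    using assms by (simp add: binomial_quotient_def num)
qed

lemma int_binomial_central:
  "int_binomial (2 * int n) (int n) = 2 ^ (2 * n) * pochhammer (1 / 2) n / fact n"
proof -
  have "int_binomial (2 * int n) (int n) = real (2 * n choose n)"
    by (simp add: int_binomial_gchoose binomial_gbinomial)
  also have "\<dots> = fact (2 * n) / (fact n * fact n)"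
    by (simp add: binomial_fact)
  finally show ?thesis
    by (simp add: fact_double)
qed

lemma pochhammer_neq_0_of_int_binomial:
  assumes "int_binomial (2 * int (k + l) - 1) (2 * int l) \<noteq> 0"
  shows "pochhammer (real k) l \<noteq> 0"
proof -
  have "int_binomial (2 * int (k + l) - 1) (2 * int l) =
      (2 * (real k + real l) - 1) gchoose (2 * l)"
    using int_binomial_gchoose [of "2 * int (k + l) - 1" "2 * l"] by simp
  also have "\<dots> = pochhammer (2 * real k) (2 * l) / fact (2 * l)"
    by (simp add: gbinomial_pochhammer' algebra_simps)
  finally show ?thesis
    using assms by (auto simp: pochhammer_double)
qed

lemma tendsto_binomial_quotient:
  "(binomial_quotient l \<longlongrightarrow> pochhammer (1 / 2) l / pochhammer (real k + 1 / 2) l) (at (real k))"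
proof -
  have "((\<lambda>x. pochhammer (x + 1 / 2) l) \<longlongrightarrow> pochhammer (real k + 1 / 2) l) (at (real k))"
    by (intro isCont_tendsto_compose [OF isCont_pochhammer] tendsto_intros)
  moreover have "pochhammer (real k + 1 / 2) l \<noteq> 0"
    using pochhammer_pos [of "real k + 1 / 2" l] by simp
  ultimately have "((\<lambda>x. pochhammer (1 / 2) l / pochhammer (x + 1 / 2) l) \<longlongrightarrow>
      pochhammer (1 / 2) l / pochhammer (real k + 1 / 2) l) (at (real k))"
    by (intro tendsto_intros)
  moreover have "\<forall>\<^sub>F x in at (real k).
      pochhammer (1 / 2) l / pochhammer (x + 1 / 2) l = binomial_quotient l x"
  proof -
    have "finite {x :: real. pochhammer x l = 0}"
      by (rule finite_subset [of _ "(\<lambda>j. - real j) ` {..<l}"])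
        (auto simp: pochhammer_eq_0_iff)
    then have "\<forall>\<^sub>F x in at (real k). x \<notin> {x. pochhammer x l = 0}"
      by (metis islimpt_finite islimpt_iff_eventually)
    then show ?thesis
      by eventually_elim (simp add: binomial_quotient_eq)
  qed
  ultimately show ?thesis
    by (rule Lim_transform_eventually)
qed

text \<open>The product $(1/2)_{k+l} = (1/2)_k\,(k+1/2)_l$ cancels the denominator $(k+1/2)_l$.\<close>

lemma integral_cos_sin_even_powers_eq_central_binomial:
  "integral {0..2 * pi} (\<lambda>\<theta>. cos \<theta> ^ (2 * k) * sin \<theta> ^ (2 * l)) =
     2 * pi * 2 powi (- 2 * int (k + l)) *
     (pochhammer (1 / 2) l / pochhammer (real k + 1 / 2) l *
      int_binomial (2 * int (k + l)) (int (k + l)))"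
proof -
  have powi: "2 powi (- 2 * int n) = 1 / (2 :: real) ^ (2 * n)" for n
    using power_int_minus [of "2 :: real" "int (2 * n)"]
    unfolding power_int_of_nat by (simp add: field_simps)
  have "pochhammer (real k + 1 / 2) l \<noteq> 0"
    using pochhammer_pos [of "real k + 1 / 2" l] by simp
  moreover have "pochhammer (1 / 2) (k + l) =
      pochhammer (1 / 2) k * pochhammer (real k + 1 / 2) l"
    using pochhammer_product' [of "1 / 2 :: real" k l] by (simp add: add.commute)
  ultimately show ?thesis
    unfolding integral_cos_sin_even_powers int_binomial_central powi
    by (simp add: field_simps)
qed

theorem theorem10p1:
  fixes k l :: nat
  shows
    "(int_binomial (2 * int (k + l) - 1) (2 * int l) \<noteq> 0 \<longrightarrow>
       integral {0..2 * pi} (\<lambda>\<theta>. cos \<theta> ^ (2 * k) * sin \<theta> ^ (2 * l)) =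
         2 * pi * 2 powi (- 2 * int (k + l)) *
         (int_binomial (int (k + l) - 1) (int l) * int_binomial (2 * int (k + l)) (int (k + l)) /
          int_binomial (2 * int (k + l) - 1) (2 * int l)))
     \<and>
     (int_binomial (2 * int (k + l) - 1) (2 * int l) = 0 \<longrightarrow>
       ((\<lambda>x. 2 * pi * 2 powi (- 2 * int (k + l)) *
             (binomial_quotient l x * int_binomial (2 * int (k + l)) (int (k + l))))
          \<longlongrightarrow> integral {0..2 * pi} (\<lambda>\<theta>. cos \<theta> ^ (2 * k) * sin \<theta> ^ (2 * l))) (at (real k)))"
proof (intro conjI impI)
  assume "int_binomial (2 * int (k + l) - 1) (2 * int l) \<noteq> 0"
  then have "binomial_quotient l (real k) =
      pochhammer (1 / 2) l / pochhammer (real k + 1 / 2) l"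
    by (intro binomial_quotient_eq pochhammer_neq_0_of_int_binomial)
  then show "integral {0..2 * pi} (\<lambda>\<theta>. cos \<theta> ^ (2 * k) * sin \<theta> ^ (2 * l)) =
      2 * pi * 2 powi (- 2 * int (k + l)) *
      (int_binomial (int (k + l) - 1) (int l) * int_binomial (2 * int (k + l)) (int (k + l)) /
       int_binomial (2 * int (k + l) - 1) (2 * int l))"
    unfolding integral_cos_sin_even_powers_eq_central_binomial
    by (simp only: binomial_quotient_of_nat flip: times_divide_eq_left)
next
  show "((\<lambda>x. 2 * pi * 2 powi (- 2 * int (k + l)) *
             (binomial_quotient l x * int_binomial (2 * int (k + l)) (int (k + l))))
          \<longlongrightarrow> integral {0..2 * pi} (\<lambda>\<theta>. cos \<theta> ^ (2 * k) * sin \<theta> ^ (2 * l))) (at (real k))"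
    unfolding integral_cos_sin_even_powers_eq_central_binomial
    by (intro tendsto_mult tendsto_const tendsto_binomial_quotient)
qed

end
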